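(* Let $R$ be a commutative ring with unity, $Y\subseteq\mathrm{Spec}(R)$ and $J$ an ideal of $R$. If $J$ is a strong $\mathcal{H}_Y$-ideal, then $(J:I)$ is a strong $\mathcal{H}_Y$-ideal for every ideal $I$ of $R$. Likewise, if $J$ is an $\mathcal{H}_Y$-ideal (respectively, a $Y$-Hilbert ideal), then $(J:I)$ is an $\mathcal{H}_Y$-ideal (respectively, a $Y$-Hilbert ideal) for every ideal $I$ of $R$.
   Context: $h_Y(S)=\{P\in Y: S\subseteq P\}$ for $S\subseteq R$, $h_Y(a)=h_Y(\{a\})$, and for $X\subseteq Y$, $k(X)=\bigcap_{P\in X}P$ (with $k(\emptyset)=R$); $kh_Y(S)=k(h_Y(S))$. An ideal $I$ of $R$ (not necessarily proper) is an $\mathcal{H}_Y$-ideal if $a\in I$, $b\in R$ and $h_Y(a)\subseteq h_Y(b)$ imply $b\in I$. It is a strong $\mathcal{H}_Y$-ideal if for every finite subset $F\subseteq I$ and every $b\in R$, $h_Y(F)\subseteq h_Y(b)$ implies $b\in I$. It is a $Y$-Hilbert ideal if $I=kh_Y(I)$, i.e. $I$ is an intersection of elements of some subfamily of $Y$. $(J:I)=\{x\in R: xI\subseteq J\}$. *)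

theory Defs
  imports "HOL-Algebra.Ideal" "HOL-Algebra.Coset"
begin

definition Spec :: "('a, 'b) ring_scheme \<Rightarrow> 'a set set"
  where "Spec R = {P. primeideal P R}"

definition hull :: "'a set set \<Rightarrow> 'a set \<Rightarrow> 'a set set"
  where "hull Y S = {P \<in> Y. S \<subseteq> P}"

text \<open>Intersecting with the carrier only matters for the empty family, whose kernel is the whole ring.\<close>

definition kernel_of :: "('a, 'b) ring_scheme \<Rightarrow> 'a set set \<Rightarrow> 'a set"
  where "kernel_of R X = carrier R \<inter> \<Inter>X"

definition H_ideal :: "('a, 'b) ring_scheme \<Rightarrow> 'a set set \<Rightarrow> 'a set \<Rightarrow> bool"
  where "H_ideal R Y I \<longleftrightarrow> ideal I R \<and>
    (\<forall>a\<in>I. \<forall>b\<in>carrier R. hull Y {a} \<subseteq> hull Y {b} \<longrightarrow> b \<in> I)"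

definition strong_H_ideal :: "('a, 'b) ring_scheme \<Rightarrow> 'a set set \<Rightarrow> 'a set \<Rightarrow> bool"
  where "strong_H_ideal R Y I \<longleftrightarrow> ideal I R \<and>
    (\<forall>F b. finite F \<and> F \<subseteq> I \<and> b \<in> carrier R \<and> hull Y F \<subseteq> hull Y {b} \<longrightarrow> b \<in> I)"

definition Hilbert_ideal :: "('a, 'b) ring_scheme \<Rightarrow> 'a set set \<Rightarrow> 'a set \<Rightarrow> bool"
  where "Hilbert_ideal R Y I \<longleftrightarrow> ideal I R \<and> I = kernel_of R (hull Y I)"

text \<open>The left coset taken here is multiplicative: \<open>x <#\<^bsub>R\<^esub> I\<close> is the set of products of \<open>x\<close>
  with elements of \<open>I\<close>. The argument order follows the notation \<open>(J : I)\<close>.\<close>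

definition colon_ideal :: "('a, 'b) ring_scheme \<Rightarrow> 'a set \<Rightarrow> 'a set \<Rightarrow> 'a set"
  where "colon_ideal R J I = {x \<in> carrier R. x <#\<^bsub>R\<^esub> I \<subseteq> J}"

end

theory Submission
  imports Defs
begin

text \<open>Multiplying by a ring element preserves inclusions of hulls: a prime containing every
  \<open>s \<otimes> c\<close> contains \<open>c\<close> or contains every \<open>s\<close>. Hence a closure condition on \<open>J\<close> transfers to
  \<open>(J : I)\<close> by testing \<open>b \<otimes> c \<in> J\<close> separately for each \<open>c \<in> I\<close>.\<close>

lemma mem_colon_ideal_iff:
  "x \<in> colon_ideal R J I \<longleftrightarrow> x \<in> carrier R \<and> (\<forall>c\<in>I. x \<otimes>\<^bsub>R\<^esub> c \<in> J)"
  by (auto simp: colon_ideal_def l_coset_def)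

lemma colon_ideal_ideal:
  assumes "cring R" and J: "ideal J R" and I: "ideal I R"
  shows "ideal (colon_ideal R J I) R"
proof -
  interpret cring R by fact
  interpret J: ideal J R by fact
  interpret I: ideal I R by fact
  \<comment> \<open>Commutativity moves \<open>a\<close> next to \<open>c\<close>: the product ac
    already lies in \<open>J\<close>, and the factor \<open>x\<close> is then absorbed by
    \<open>J\<close>. The absorption law on the other side follows from this one.\<close>
  have closed: "a \<otimes>\<^bsub>R\<^esub> x \<in> colon_ideal R J I"
    if "a \<in> colon_ideal R J I" "x \<in> carrier R" for a x
  proof -
    have "a \<otimes>\<^bsub>R\<^esub> x \<otimes>\<^bsub>R\<^esub> c = x \<otimes>\<^bsub>R\<^esub> (a \<otimes>\<^bsub>R\<^esub> c)" if "c \<in> I" for c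
      using that \<open>a \<in> _\<close> \<open>x \<in> _\<close> I.Icarr by (simp add: mem_colon_ideal_iff m_ac)
    then show ?thesis
      using that by (simp add: mem_colon_ideal_iff J.I_l_closed)
  qed
  show ?thesis
  proof (rule idealI)
    show "subgroup (colon_ideal R J I) (add_monoid R)"
    proof (rule add.subgroupI)
      show "colon_ideal R J I \<subseteq> carrier R"
        by (auto simp: mem_colon_ideal_iff)
      have "\<zero>\<^bsub>R\<^esub> \<in> colon_ideal R J I"
        by (simp add: mem_colon_ideal_iff I.Icarr)
      then show "colon_ideal R J I \<noteq> {}" by blast
    qed (auto simp: mem_colon_ideal_iff I.Icarr l_distr l_minus)
    show "x \<otimes>\<^bsub>R\<^esub> a \<in> colon_ideal R J I"
      if "a \<in> colon_ideal R J I" "x \<in> carrier R" for a x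
      using closed[OF that] that by (simp add: mem_colon_ideal_iff m_comm)
  qed (use closed ring_axioms in blast)+
qed

text \<open>The set \<open>S\<close> is left arbitrary because the three closure conditions compare
  \<open>b\<close> with different sets: a singleton, a finite set, or all of (J : I).\<close>

lemma hull_mult_mono:
  assumes Y: "Y \<subseteq> Spec R" and S: "S \<subseteq> carrier R" and b: "b \<in> carrier R" and c: "c \<in> carrier R"
    and sub: "hull Y S \<subseteq> hull Y {b}"
  shows "hull Y ((\<lambda>s. s \<otimes>\<^bsub>R\<^esub> c) ` S) \<subseteq> hull Y {b \<otimes>\<^bsub>R\<^esub> c}"
proof
  fix P assume P: "P \<in> hull Y ((\<lambda>s. s \<otimes>\<^bsub>R\<^esub> c) ` S)"
  then have "P \<in> Y" and in_P: "\<And>s. s \<in> S \<Longrightarrow> s \<otimes>\<^bsub>R\<^esub> c \<in> P"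
    by (auto simp: hull_def)
  then interpret primeideal P R using Y by (auto simp: Spec_def)
  have "b \<otimes>\<^bsub>R\<^esub> c \<in> P"
  proof (cases "c \<in> P")
    case True
    then show ?thesis using b by (rule I_l_closed)
  next
    \<comment> \<open>Primality is applied to each product sc separately, so no bound on the size of
      \<open>S\<close> enters.\<close>
    case False
    then have "S \<subseteq> P" using in_P I_prime S c by blast
    then have "b \<in> P" using sub \<open>P \<in> Y\<close> by (auto simp: hull_def)
    then show ?thesis using c by (rule I_r_closed)
  qed
  then show "P \<in> hull Y {b \<otimes>\<^bsub>R\<^esub> c}" using \<open>P \<in> Y\<close> by (simp add: hull_def)
qed

lemma strong_H_ideal_colon_ideal:
  assumes R: "cring R" and Y: "Y \<subseteq> Spec R" and J: "strong_H_ideal R Y J" and I: "ideal I R"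
  shows "strong_H_ideal R Y (colon_ideal R J I)"
  unfolding strong_H_ideal_def
proof (intro conjI allI impI; (elim conjE)?)
  show "ideal (colon_ideal R J I) R"
    using R J I by (simp add: strong_H_ideal_def colon_ideal_ideal)
  fix F b
  assume F: "finite F" "F \<subseteq> colon_ideal R J I" and b: "b \<in> carrier R"
    and sub: "hull Y F \<subseteq> hull Y {b}"
  have "b \<otimes>\<^bsub>R\<^esub> c \<in> J" if "c \<in> I" for c
  proof -
    have c: "c \<in> carrier R" using I that by (rule ideal.Icarr)
    have "F \<subseteq> carrier R" using F by (auto simp: mem_colon_ideal_iff)
    then have "hull Y ((\<lambda>s. s \<otimes>\<^bsub>R\<^esub> c) ` F) \<subseteq> hull Y {b \<otimes>\<^bsub>R\<^esub> c}"
      using Y b c sub by (intro hull_mult_mono)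
    \<comment> \<open>The closure condition of \<open>J\<close> is tested on the set of products of
      \<open>F\<close> with \<open>c\<close>: \<open>F\<close> itself may lie outside
      \<open>J\<close>, but these products lie in \<open>J\<close> and are still finite in
      number.\<close>
    moreover have "(\<lambda>s. s \<otimes>\<^bsub>R\<^esub> c) ` F \<subseteq> J"
      using F that by (auto simp: mem_colon_ideal_iff)
    moreover have "b \<otimes>\<^bsub>R\<^esub> c \<in> carrier R"
      using R b c by (simp add: cring.cring_simprules)
    ultimately show ?thesis
      using J F(1) unfolding strong_H_ideal_def by blast
  qed
  then show "b \<in> colon_ideal R J I" using b by (simp add: mem_colon_ideal_iff)
qed

lemma H_ideal_colon_ideal:
  assumes R: "cring R" and Y: "Y \<subseteq> Spec R" and J: "H_ideal R Y J" and I: "ideal I R"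
  shows "H_ideal R Y (colon_ideal R J I)"
  unfolding H_ideal_def
proof (intro conjI ballI impI)
  show "ideal (colon_ideal R J I) R"
    using R J I by (simp add: H_ideal_def colon_ideal_ideal)
  fix a b
  assume a: "a \<in> colon_ideal R J I" and b: "b \<in> carrier R"
    and sub: "hull Y {a} \<subseteq> hull Y {b}"
  have "b \<otimes>\<^bsub>R\<^esub> c \<in> J" if "c \<in> I" for c
  proof -
    have c: "c \<in> carrier R" using I that by (rule ideal.Icarr)
    \<comment> \<open>Multiplying a singleton by \<open>c\<close> gives a singleton again, so the
      comparison stays between hulls of single elements, as the condition on \<open>J\<close>
      demands.\<close>
    have "hull Y {a \<otimes>\<^bsub>R\<^esub> c} \<subseteq> hull Y {b \<otimes>\<^bsub>R\<^esub> c}"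
      using hull_mult_mono[OF Y _ b c sub] a by (simp add: mem_colon_ideal_iff)
    moreover have "a \<otimes>\<^bsub>R\<^esub> c \<in> J"
      using a that by (simp add: mem_colon_ideal_iff)
    moreover have "b \<otimes>\<^bsub>R\<^esub> c \<in> carrier R"
      using R b c by (simp add: cring.cring_simprules)
    ultimately show ?thesis
      using J unfolding H_ideal_def by blast
  qed
  then show "b \<in> colon_ideal R J I" using b by (simp add: mem_colon_ideal_iff)
qed

text \<open>This brings the Hilbert condition into the shape of the other two: closure under an
  inclusion of hulls, tested against the whole ideal at once. When no member of \<open>Y\<close>
  contains \<open>S\<close>, both sides reduce to membership in the carrier.\<close>

lemma mem_kernel_of_hull_iff:
  "b \<in> kernel_of R (hull Y S) \<longleftrightarrow> b \<in> carrier R \<and> hull Y S \<subseteq> hull Y {b}"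
  by (auto simp: kernel_of_def hull_def)

lemma Hilbert_ideal_colon_ideal:
  assumes R: "cring R" and Y: "Y \<subseteq> Spec R" and J: "Hilbert_ideal R Y J" and I: "ideal I R"
  shows "Hilbert_ideal R Y (colon_ideal R J I)"
  unfolding Hilbert_ideal_def
proof (intro conjI subset_antisym subsetI)
  let ?K = "colon_ideal R J I"
  show "ideal ?K R"
    using R J I unfolding Hilbert_ideal_def by (blast intro: colon_ideal_ideal)
  \<comment> \<open>Any set of ring elements lies in the kernel of its own hull. The equation J =
    kh(J) enters in the reverse inclusion.\<close>
  show "b \<in> kernel_of R (hull Y ?K)" if "b \<in> ?K" for b
    using that unfolding mem_kernel_of_hull_iff by (auto simp: hull_def mem_colon_ideal_iff)
  fix b assume "b \<in> kernel_of R (hull Y ?K)"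
  then have b: "b \<in> carrier R" and sub: "hull Y ?K \<subseteq> hull Y {b}"
    by (simp_all add: mem_kernel_of_hull_iff)
  have "b \<otimes>\<^bsub>R\<^esub> c \<in> J" if "c \<in> I" for c
  proof -
    have c: "c \<in> carrier R" using I that by (rule ideal.Icarr)
    have "(\<lambda>s. s \<otimes>\<^bsub>R\<^esub> c) ` ?K \<subseteq> J"
      using that by (auto simp: mem_colon_ideal_iff)
    \<comment> \<open>Hulls reverse inclusions, so every member of \<open>Y\<close> above
      \<open>J\<close> also lies above the products of \<open>?K\<close> with \<open>c\<close>. The
      chain then puts bc into all of these primes, hence into kh(J) = J.\<close>
    then have "hull Y J \<subseteq> hull Y ((\<lambda>s. s \<otimes>\<^bsub>R\<^esub> c) ` ?K)"
      by (auto simp: hull_def)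
    also have "\<dots> \<subseteq> hull Y {b \<otimes>\<^bsub>R\<^esub> c}"
      using Y b c sub by (intro hull_mult_mono) (auto simp: mem_colon_ideal_iff)
    finally have "b \<otimes>\<^bsub>R\<^esub> c \<in> kernel_of R (hull Y J)"
      using R b c by (simp add: mem_kernel_of_hull_iff cring.cring_simprules)
    then show ?thesis using J unfolding Hilbert_ideal_def by blast
  qed
  then show "b \<in> ?K" using b by (simp add: mem_colon_ideal_iff)
qed

theorem proposition5p1:
  fixes R :: "('a, 'b) ring_scheme" and Y :: "'a set set" and J :: "'a set"
  assumes "cring R" and "Y \<subseteq> Spec R" and "ideal J R"
  shows "(strong_H_ideal R Y J \<longrightarrow>
            (\<forall>I. ideal I R \<longrightarrow> strong_H_ideal R Y (colon_ideal R J I)))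
       \<and> (H_ideal R Y J \<longrightarrow>
            (\<forall>I. ideal I R \<longrightarrow> H_ideal R Y (colon_ideal R J I)))
       \<and> (Hilbert_ideal R Y J \<longrightarrow>
            (\<forall>I. ideal I R \<longrightarrow> Hilbert_ideal R Y (colon_ideal R J I)))"
  using strong_H_ideal_colon_ideal[OF assms(1,2)] H_ideal_colon_ideal[OF assms(1,2)]
    Hilbert_ideal_colon_ideal[OF assms(1,2)]
  by simp

end
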